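(* For $d\ge 2$ let $D_d(n)$ be the largest number such that every arrangement of $n$ hyperplanes in $\mathbb{R}^d$ in general position contains a subset of $D_d(n)$ hyperplanes whose induced $d$-simplices all have distinct $d$-volumes. Then: (1) there is an absolute constant $c>0$ such that $$D_2(n)\ll n(\log n)^{-c};$$ (2) for every $d\ge 3$ there is $c_d\in(0,1)$ such that $$D_d(n)\ll n\,e^{-(\log\log n)^{c_d}}.$$
   Context: An arrangement $\mathcal{A}$ of at least $d+1$ hyperplanes in $\mathbb{R}^d$ is in general position if every $d$ of its hyperplanes intersect in exactly one point and no $d+1$ of them have a common point. Any $d+1$ hyperplanes of such an arrangement form a unique $d$-simplex, the bounded cell of the arrangement of these $d+1$ hyperplanes. The $d$-simplices induced by a subset $\mathcal{S}\subseteq\mathcal{A}$ are those formed by the $(d+1)$-element subsets of $\mathcal{S}$; they all have distinct $d$-volumes if different $(d+1)$-element subsets of $\mathcal{S}$ give simplices of different $d$-dimensional volume. The notation $F(n)\ll G(n)$ means $F(n)\le C\,G(n)$ for all $n\ge d+1$, with a constant $C$ not depending on $n$ (it may depend on $d$). *)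

theory Defs
  imports "HOL-Analysis.Analysis"
begin

definition hyperplane :: "'a::euclidean_space set \<Rightarrow> bool" where
  "hyperplane H \<longleftrightarrow> (\<exists>a b. a \<noteq> 0 \<and> H = {x. a \<bullet> x = b})"

definition general_position :: "'a::euclidean_space set set \<Rightarrow> bool" where
  "general_position \<A> \<longleftrightarrow>
     finite \<A> \<and> DIM('a) + 1 \<le> card \<A> \<and> (\<forall>H\<in>\<A>. hyperplane H) \<and>
     (\<forall>\<T>\<subseteq>\<A>. card \<T> = DIM('a) \<longrightarrow> (\<exists>!x. x \<in> \<Inter>\<T>)) \<and>
     (\<forall>\<T>\<subseteq>\<A>. card \<T> = DIM('a) + 1 \<longrightarrow> \<Inter>\<T> = {})"

definition cells :: "'a::euclidean_space set set \<Rightarrow> 'a set set" where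
  "cells \<T> = components (- \<Union>\<T>)"

text \<open>For \<open>DIM('a) + 1\<close> hyperplanes in general position exactly one cell is bounded.
  Cells are open; the closure is taken to obtain the simplex itself, and does not affect
  the volume.\<close>

definition induced_simplex :: "'a::euclidean_space set set \<Rightarrow> 'a set" where
  "induced_simplex \<T> = closure (THE c. c \<in> cells \<T> \<and> bounded c)"

definition distinct_volumes :: "'a::euclidean_space set set \<Rightarrow> bool" where
  "distinct_volumes \<S> \<longleftrightarrow>
     inj_on (\<lambda>\<T>. measure lborel (induced_simplex \<T>)) {\<T>. \<T> \<subseteq> \<S> \<and> card \<T> = DIM('a) + 1}"

text \<open>The quantity \<open>D\<^sub>d(n)\<close>, where the dimension \<open>d\<close> is that of the space passed as a type
  argument. It is meaningful for \<open>n \<ge> d + 1\<close>: then arrangements in general position exist,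
  so the numbers \<open>m\<close> in question are bounded by \<open>n\<close>.\<close>

definition distinct_volume_number :: "'a::euclidean_space itself \<Rightarrow> nat \<Rightarrow> nat" where
  "distinct_volume_number _ n =
     (GREATEST m. \<forall>\<A> :: 'a set set. general_position \<A> \<and> card \<A> = n \<longrightarrow>
        (\<exists>\<S>\<subseteq>\<A>. card \<S> = m \<and> distinct_volumes \<S>))"

end

theory Submission
  imports Defs "HOL-Computational_Algebra.Polynomial"
begin

text \<open>Both bounds follow from one much stronger estimate, \<open>D\<^sub>d(n) \<le> (d + 1) n\<^bsup>d/(d+1)\<^esup>\<close>
(\<open>distinct_volume_number_le_powr\<close>), valid in every Euclidean space of dimension \<open>d \<ge> 1\<close>.

The points of a \<open>d\<close>-dimensional space are identified with the monic real polynomials of degree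
\<open>d\<close>, a point being the vector of the lower coefficients. The polynomials that vanish at a real
number \<open>t\<close> form a hyperplane \<open>H\<^sub>t\<close>. These hyperplanes are in general position, because a monic
polynomial of degree \<open>d\<close> is determined by \<open>d\<close> distinct roots and cannot have \<open>d + 1\<close> of them. The
arrangement that proves the estimate is \<open>H\<^sub>0, ..., H\<^bsub>n-1\<^esub>\<close>.

The substitution \<open>p(T) \<mapsto> p(T - s)\<close> is an affine bijection of the space that carries \<open>H\<^sub>t\<close> to
\<open>H\<^bsub>t+s\<^esub>\<close>. Its linear part is unitriangular in the coefficients, so it preserves volume. Hence
the simplex formed by the hyperplanes with parameters \<open>u\<^sub>0 < ... < u\<^sub>d\<close> has a volume that depends on
the differences \<open>u\<^sub>i - u\<^sub>0\<close> only, that is, on a \<open>d\<close>-element subset of \<open>{0, ..., n - 1}\<close>. If all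
simplices induced by \<open>m\<close> of the hyperplanes have distinct volumes, then
\<open>m choose (d + 1) \<le> n choose d \<le> n\<^sup>d\<close>, and the left side is at least \<open>(m/(d+1))\<^bsup>d+1\<^esup>\<close>.

The simplex of a set \<open>U\<close> of \<open>d + 1\<close> parameters is described through Lagrange interpolation: the
values of a polynomial on \<open>U\<close>, suitably weighted, are its barycentric coordinates, their signs cut
out the cells, and the all-positive cell is the bounded one.\<close>

section \<open>Unitriangular maps preserve Lebesgue measure\<close>

text \<open>Fubini's theorem: when the coordinates other than \<open>b\<close> are held fixed, the shear is a translation
of the \<open>b\<close>-coordinate.\<close>

lemma lborel_distr_shear:
  fixes b :: "'a::euclidean_space" and l :: "'a \<Rightarrow> real"
  assumes b: "b \<in> Basis" and l [measurable]: "l \<in> borel_measurable borel"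
    and indep: "\<And>x y. l (x + y *\<^sub>R b) = l x"
  shows "distr lborel borel (\<lambda>x. x + l x *\<^sub>R b) = lborel"
proof (rule measure_eqI)
  show "sets (distr lborel borel (\<lambda>x. x + l x *\<^sub>R b)) = sets lborel" by simp
next
  fix A assume "A \<in> sets (distr lborel borel (\<lambda>x. x + l x *\<^sub>R b))"
  then have A [measurable]: "A \<in> sets borel" by simp
  interpret P: product_sigma_finite "\<lambda>_::'a. lborel :: real measure"
    by standard
  let ?I = "Basis - {b}"
  let ?M = "\<lambda>I::'a set. Pi\<^sub>M I (\<lambda>_. lborel :: real measure)"
  define V where "V g = (\<Sum>c\<in>Basis. g c *\<^sub>R c)" for g :: "'a \<Rightarrow> real"
  define W where "W g = (\<Sum>c\<in>?I. g c *\<^sub>R c)" for g :: "'a \<Rightarrow> real"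
  have ins: "insert b ?I = Basis" using b by auto
  have VW: "V (g(b := y)) = W g + y *\<^sub>R b" for g y
    unfolding V_def W_def using b by (subst sum.remove[of _ b]) (auto intro!: sum.cong)
  have [measurable]: "V \<in> measurable (?M Basis) borel"
    unfolding V_def by measurable
  have split: "(\<integral>\<^sup>+x. f x \<partial>lborel) = (\<integral>\<^sup>+g. (\<integral>\<^sup>+y. f (W g + y *\<^sub>R b) \<partial>lborel) \<partial>?M ?I)"
    if [measurable]: "f \<in> borel_measurable borel" for f :: "'a \<Rightarrow> ennreal"
  proof -
    have "(\<integral>\<^sup>+x. f x \<partial>lborel) = (\<integral>\<^sup>+g. f (V g) \<partial>?M Basis)"
      by (subst lborel_eq, subst nn_integral_distr) (auto simp: V_def)
    also have "\<dots> = (\<integral>\<^sup>+g. (\<integral>\<^sup>+y. f (V (g(b := y))) \<partial>lborel) \<partial>?M ?I)"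
      using P.product_nn_integral_insert[of ?I b "\<lambda>g. f (V g)"] unfolding ins by simp
    finally show ?thesis by (simp add: VW)
  qed
  let ?f = "indicator A :: 'a \<Rightarrow> ennreal"
  have "emeasure (distr lborel borel (\<lambda>x. x + l x *\<^sub>R b)) A = (\<integral>\<^sup>+x. ?f (x + l x *\<^sub>R b) \<partial>lborel)"
    by (subst nn_integral_indicator[symmetric], simp, subst nn_integral_distr) auto
  also have "\<dots> = (\<integral>\<^sup>+g. (\<integral>\<^sup>+y. ?f (W g + (l (W g) + 1 * y) *\<^sub>R b) \<partial>lborel) \<partial>?M ?I)"
    by (subst split) (auto simp: indep algebra_simps)
  also have "\<dots> = (\<integral>\<^sup>+g. (\<integral>\<^sup>+y. ?f (W g + y *\<^sub>R b) \<partial>lborel) \<partial>?M ?I)"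
  proof (rule nn_integral_cong)
    fix g
    show "(\<integral>\<^sup>+y. ?f (W g + (l (W g) + 1 * y) *\<^sub>R b) \<partial>lborel) = (\<integral>\<^sup>+y. ?f (W g + y *\<^sub>R b) \<partial>lborel)"
      using nn_integral_real_affine[of "\<lambda>y. ?f (W g + y *\<^sub>R b)" 1 "l (W g)"] by simp
  qed
  also have "\<dots> = (\<integral>\<^sup>+x. ?f x \<partial>lborel)"
    by (subst split) auto
  finally show "emeasure (distr lborel borel (\<lambda>x. x + l x *\<^sub>R b)) A = emeasure lborel A"
    by simp
qed

text \<open>The displacement of a coordinate may depend only on coordinates of larger index. Then \<open>g\<close> is a
composition of shears, one for each coordinate in the order of increasing index: when a coordinate
gets displaced, the ones that determine its displacement still have their original values.\<close>

lemma lborel_distr_unitriangular: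
  fixes g :: "'a::euclidean_space \<Rightarrow> 'a" and r :: "'a \<Rightarrow> nat"
  assumes r: "inj_on r Basis"
    and g [measurable]: "g \<in> borel_measurable borel"
    and tri: "\<And>b c x y. b \<in> Basis \<Longrightarrow> c \<in> Basis \<Longrightarrow> r c \<le> r b \<Longrightarrow>
                (g (x + y *\<^sub>R c) - (x + y *\<^sub>R c)) \<bullet> b = (g x - x) \<bullet> b"
  shows "distr lborel borel g = lborel"
proof -
  define l where "l b x = (g x - x) \<bullet> b" for b x
  have l_meas [measurable]: "l b \<in> borel_measurable borel" for b
    unfolding l_def by measurable
  have l_sum: "l b (x + (\<Sum>c\<in>S. y c *\<^sub>R c)) = l b x"
    if "b \<in> Basis" "S \<subseteq> {c \<in> Basis. r c \<le> r b}" for b x y S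
  proof -
    have "finite S" using that(2) finite_subset[of S Basis] by auto
    then show ?thesis using that(2)
    proof (induction S)
      case (insert c S)
      then show ?case
        using tri[of b c "x + (\<Sum>c\<in>S. y c *\<^sub>R c)" "y c"] \<open>b \<in> Basis\<close>
        by (simp add: l_def add_ac)
    qed simp
  qed
  (* h k performs the displacements of the coordinates of index below k. *)
  define h where "h k x = x + (\<Sum>b | b \<in> Basis \<and> r b < k. l b x *\<^sub>R b)" for k x
  have h_meas [measurable]: "h k \<in> borel_measurable borel" for k
    unfolding h_def by measurable
  have h_distr: "distr lborel borel (h k) = lborel" for k
  proof (induction k)
    case 0
    have "h 0 = (\<lambda>x. x)" by (auto simp: h_def)
    then show ?case by (simp add: distr_id2)
  next
    case (Suc k)
    show ?case
    proof (cases "\<exists>b\<in>Basis. r b = k")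
      case False
      then have "{b \<in> Basis. r b < Suc k} = {b \<in> Basis. r b < k}"
        using less_Suc_eq by auto
      then have "h (Suc k) = h k" by (auto simp: h_def)
      with Suc show ?thesis by simp
    next
      case True
      then obtain b where b: "b \<in> Basis" "r b = k" by auto
      have set_eq: "{c \<in> Basis. r c < Suc k} = insert b {c \<in> Basis. r c < k}"
        using b r by (auto simp: less_Suc_eq inj_on_def)
      have comp: "h (Suc k) = (\<lambda>x. x + l b x *\<^sub>R b) \<circ> h k"
      proof
        fix x
        have "l b (h k x) = l b x"
          unfolding h_def using b by (intro l_sum) auto
        then show "h (Suc k) x = ((\<lambda>x. x + l b x *\<^sub>R b) \<circ> h k) x"
          unfolding o_def h_def set_eq using b by (simp add: add_ac)
      qed
      have "distr lborel borel (h (Suc k))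
              = distr (distr lborel borel (h k)) borel (\<lambda>x. x + l b x *\<^sub>R b)"
        unfolding comp by (subst distr_distr) auto
      also have "\<dots> = lborel"
        unfolding Suc.IH using b l_sum[of b "{b}" _ "\<lambda>_. _"]
        by (intro lborel_distr_shear) auto
      finally show ?thesis .
    qed
  qed
  obtain k where k: "\<And>b. b \<in> Basis \<Longrightarrow> r b < k"
  proof -
    have "finite (r ` Basis)" by simp
    then obtain m where "\<forall>n\<in>r ` Basis. n < m" using finite_nat_set_iff_bounded by blast
    then show ?thesis using that by blast
  qed
  have "g = h k"
  proof
    fix x
    have "{b \<in> Basis. r b < k} = Basis" using k by auto
    then show "g x = h k x"
      by (simp add: h_def l_def euclidean_representation)
  qed
  then show ?thesis using h_distr by simp
qed

section \<open>The bounded cell in barycentric coordinates\<close>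

text \<open>The functions \<open>f u\<close> are barycentric coordinates with respect to the vertices \<open>P u\<close>, and the cells are
cut out by the \<open>card U\<close> facet hyperplanes. On the all-positive cell each coordinate lies between 0
and 1, which bounds it. A point of another cell has a negative coordinate \<open>j\<close>, and it also has a
positive coordinate \<open>k\<close> since the coordinates sum to 1. Moving in the direction \<open>P k - P j\<close> only
makes these two coordinates larger in absolute value, so the cell contains a whole ray. The
induced simplex is defined as the closure of the bounded cell; this identifies that cell by explicit
inequalities, which can then be transported along affine maps.\<close>

lemma unique_bounded_cell:
  fixes f :: "'i \<Rightarrow> 'a::real_normed_vector \<Rightarrow> real" and P :: "'i \<Rightarrow> 'a"
  assumes U: "finite U" "U \<noteq> {}"
    and sum1: "\<And>x. (\<Sum>u\<in>U. f u x) = 1"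
    and rep: "\<And>x. (\<Sum>u\<in>U. f u x *\<^sub>R P u) = x"
    and coord: "\<And>y u. sum y U = 1 \<Longrightarrow> u \<in> U \<Longrightarrow> f u (\<Sum>v\<in>U. y v *\<^sub>R P v) = y u"
    and cont: "\<And>u. u \<in> U \<Longrightarrow> continuous_on UNIV (f u)"
  shows "(THE c. c \<in> components {x. \<forall>u\<in>U. f u x \<noteq> 0} \<and> bounded c) = {x. \<forall>u\<in>U. f u x > 0}"
proof (rule the_equality)
  let ?W = "{x. \<forall>u\<in>U. f u x \<noteq> 0}" and ?C = "{x. \<forall>u\<in>U. f u x > 0}"
  have line: "f u (x + s *\<^sub>R (y - z)) = f u x + s * (f u y - f u z)" if "u \<in> U" for u x y z s
  proof -
    let ?y = "\<lambda>v. f v x + s * (f v y - f v z)"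
    have "sum ?y U = 1"
      by (simp add: sum.distrib sum1 flip: sum_distrib_left add: sum_subtractf)
    moreover have "(\<Sum>v\<in>U. ?y v *\<^sub>R P v) = x + s *\<^sub>R (y - z)"
      by (simp add: scaleR_left.add scaleR_left.diff sum.distrib sum_subtractf rep
            flip: scaleR_scaleR scaleR_sum_right add: scaleR_diff_right)
    ultimately show ?thesis using coord[of ?y u] that by simp
  qed
  have conv: "convex ?C"
    unfolding convex_alt
  proof safe
    fix x y :: 'a and s :: real and u
    assume *: "\<forall>u\<in>U. 0 < f u x" "\<forall>u\<in>U. 0 < f u y" "0 \<le> s" "s \<le> 1" "u \<in> U"
    have "(1 - s) *\<^sub>R x + s *\<^sub>R y = x + s *\<^sub>R (y - x)" by (simp add: algebra_simps)
    then have "f u ((1 - s) *\<^sub>R x + s *\<^sub>R y) = (1 - s) * f u x + s * f u y"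
      using line[OF \<open>u \<in> U\<close>, of x s y x] by (simp add: algebra_simps)
    moreover have "0 < (1 - s) * f u x + s * f u y"
      using * by (cases "s = 0") (auto intro!: add_nonneg_pos)
    ultimately show "0 < f u ((1 - s) *\<^sub>R x + s *\<^sub>R y)" by simp
  qed
  have bdd: "bounded ?C"
  proof -
    have "norm x \<le> (\<Sum>u\<in>U. norm (P u))" if x: "x \<in> ?C" for x
    proof -
      have le1: "\<bar>f u x\<bar> \<le> 1" if "u \<in> U" for u
      proof -
        have pos: "f v x \<ge> 0" if "v \<in> U" for v using x that by (simp add: less_imp_le)
        have "f u x \<le> (\<Sum>v\<in>U. f v x)" using U that pos by (intro member_le_sum) auto
        with pos[OF that] show ?thesis by (simp add: sum1)
      qed
      have "norm x = norm (\<Sum>u\<in>U. f u x *\<^sub>R P u)" by (simp add: rep)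
      also have "\<dots> \<le> (\<Sum>u\<in>U. norm (P u))"
        using le1 by (intro sum_norm_le) (simp add: mult_left_le_one_le)
      finally show ?thesis .
    qed
    then show ?thesis unfolding bounded_iff by blast
  qed
  have ne: "?C \<noteq> {}"
  proof -
    have "f u (\<Sum>v\<in>U. (1 / card U) *\<^sub>R P v) = 1 / card U" if "u \<in> U" for u
      using coord[of "\<lambda>_. 1 / card U" u] U that by simp
    moreover have "1 / real (card U) > 0" using U by (simp add: card_gt_0_iff)
    ultimately have "(\<Sum>v\<in>U. (1 / card U) *\<^sub>R P v) \<in> ?C" by simp
    then show ?thesis by blast
  qed
  have constant_sign: "f u y > 0"
    if D: "connected D" "D \<subseteq> ?W" and x: "x \<in> D" "f u x > 0" and y: "y \<in> D" and u: "u \<in> U"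
    for D x y u
  proof (rule ccontr)
    assume "\<not> f u y > 0"
    moreover have "connected (f u ` D)"
      using D(1) cont[OF u] connected_continuous_image continuous_on_subset by blast
    ultimately have "0 \<in> f u ` D"
      using connected_contains_Icc[of "f u ` D" "f u y" "f u x"] x y by auto
    then show False using D u by auto
  qed
  show "?C \<in> components ?W \<and> bounded ?C"
  proof (intro conjI bdd in_components_maximal[THEN iffD2] ne allI impI)
    show "?C \<subseteq> ?W" by auto
    show "connected ?C" using conv convex_connected by blast
    fix D assume D: "D \<noteq> {} \<and> ?C \<subseteq> D \<and> D \<subseteq> ?W \<and> connected D"
    obtain x where "x \<in> ?C" using ne by blast
    then have "D \<subseteq> ?C" using constant_sign[of D x] D by blast
    then show "D = ?C" using D by blast
  qed
  fix c assume c: "c \<in> components ?W \<and> bounded c"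
  then have cW: "c \<subseteq> ?W" "connected c" "c \<noteq> {}"
    by (simp_all add: in_components_maximal)
  have "c \<subseteq> ?C"
  proof (rule ccontr)
    assume "\<not> c \<subseteq> ?C"
    then obtain x j where x: "x \<in> c" and j: "j \<in> U" "f j x < 0" using cW by fastforce
    obtain k where k: "k \<in> U" "f k x > 0"
    proof (rule ccontr)
      assume "\<not> thesis"
      then have "(\<Sum>u\<in>U. f u x) \<le> 0" using that by (intro sum_nonpos) force
      then show False using sum1[of x] by simp
    qed
    have jk: "j \<noteq> k" using j k by auto
    have vert: "f u (P v) = (if u = v then 1 else 0)" if "u \<in> U" "v \<in> U" for u v
    proof -
      have "(\<Sum>w\<in>U. (if w = v then 1 else 0) *\<^sub>R P w) = P v"
        using U that by (subst sum.remove[of _ v]) (auto intro!: sum.neutral)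
      then show ?thesis
        using coord[of "\<lambda>w. if w = v then 1 else 0" u] U that by simp
    qed
    let ?ray = "(\<lambda>s. x + s *\<^sub>R (P k - P j)) ` {0..}"
    have ray: "f u (x + s *\<^sub>R (P k - P j)) = f u x + s * ((if u = k then 1 else 0) - (if u = j then 1 else 0))"
      if "u \<in> U" for u s using line[OF that] vert that j k by simp
    have "?ray \<subseteq> c"
    proof (rule components_maximal)
      show "c \<in> components ?W" using c by simp
      show "connected ?ray"
        by (intro connected_continuous_image continuous_intros) auto
      show "c \<inter> ?ray \<noteq> {}" using x by force
      show "?ray \<subseteq> ?W"
      proof (rule image_subsetI, unfold mem_Collect_eq, intro ballI notI)
        fix s u assume s: "(s::real) \<in> {0..}" and u: "u \<in> U" and "f u (x + s *\<^sub>R (P k - P j)) = 0"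
        then have "f u x + s * ((if u = k then 1 else 0) - (if u = j then 1 else 0)) = 0"
          using ray by simp
        moreover have "f u x \<noteq> 0" using x u cW by auto
        ultimately show False using s j k jk by (auto split: if_splits)
      qed
    qed
    then have "bounded ?ray" using c bounded_subset by blast
    then obtain B where B: "\<And>s. s \<ge> 0 \<Longrightarrow> norm (x + s *\<^sub>R (P k - P j)) \<le> B"
      unfolding bounded_iff by auto
    have "P k \<noteq> P j" using vert[of k k] vert[of k j] j k jk by auto
    then have pos: "norm (P k - P j) > 0" by simp
    define s where "s = (\<bar>B\<bar> + norm x + 1) / norm (P k - P j)"
    have s0: "s \<ge> 0" using pos by (simp add: s_def)
    have "norm (s *\<^sub>R (P k - P j)) = \<bar>B\<bar> + norm x + 1"
      using s0 pos by (simp add: s_def)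
    moreover have "norm (s *\<^sub>R (P k - P j)) \<le> norm (x + s *\<^sub>R (P k - P j)) + norm x"
      using norm_triangle_ineq4[of "x + s *\<^sub>R (P k - P j)" x] by simp
    ultimately show False using B[OF s0] by linarith
  qed
  moreover have "?C \<subseteq> c"
  proof (rule components_maximal)
    show "c \<in> components ?W" using c by simp
    show "connected ?C" using conv convex_connected by blast
    show "?C \<subseteq> ?W" by auto
    show "c \<inter> ?C \<noteq> {}" using calculation cW by blast
  qed
  ultimately show "c = ?C" by blast
qed

section \<open>Points as monic polynomials\<close>

text \<open>An arbitrary enumeration of the basis, which decides the power of the variable that each coordinate
multiplies.\<close>

definition basis_index :: "'a::euclidean_space \<Rightarrow> nat" where
  "basis_index = (SOME r. bij_betw r Basis {..<DIM('a)})"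

lemma bij_basis_index: "bij_betw basis_index (Basis :: 'a::euclidean_space set) {..<DIM('a)}"
proof -
  have "\<exists>r. bij_betw r (Basis :: 'a set) {..<DIM('a)}"
    using ex_bij_betw_finite_nat[of "Basis :: 'a set"] by (simp add: atLeast0LessThan)
  then show ?thesis unfolding basis_index_def by (rule someI_ex)
qed

lemma basis_index_less: "b \<in> Basis \<Longrightarrow> basis_index b < DIM('a)" for b :: "'a::euclidean_space"
  using bij_basis_index[where 'a='a] by (auto simp: bij_betw_def)

lemma basis_index_eq_iff:
  "b \<in> Basis \<Longrightarrow> c \<in> Basis \<Longrightarrow> basis_index b = basis_index c \<longleftrightarrow> b = c" for b c :: "'a::euclidean_space"
  using bij_basis_index[where 'a='a] by (auto simp: bij_betw_def inj_on_def)

definition monic_poly :: "'a::euclidean_space \<Rightarrow> real poly" where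
  "monic_poly x = monom 1 DIM('a) + (\<Sum>b\<in>Basis. monom (x \<bullet> b) (basis_index b))"

definition coeff_vector :: "real poly \<Rightarrow> 'a::euclidean_space" where
  "coeff_vector p = (\<Sum>b\<in>Basis. coeff p (basis_index b) *\<^sub>R b)"

lemma coeff_vector_inner: "b \<in> Basis \<Longrightarrow> coeff_vector p \<bullet> b = coeff p (basis_index b)"
  by (simp add: coeff_vector_def)

lemma coeff_vector_add: "coeff_vector (p + q) = coeff_vector p + coeff_vector q"
  and coeff_vector_smult: "coeff_vector (smult c p) = c *\<^sub>R coeff_vector p"
  and coeff_vector_sum: "coeff_vector (sum h A) = (\<Sum>i\<in>A. coeff_vector (h i))"
  by (rule euclidean_eqI, simp add: coeff_vector_inner inner_add_left inner_sum_left coeff_sum)+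

lemma coeff_monic_poly_index:
  "b \<in> Basis \<Longrightarrow> coeff (monic_poly x) (basis_index b) = x \<bullet> b" for x b :: "'a::euclidean_space"
proof -
  assume b: "b \<in> Basis"
  have "(\<Sum>c\<in>Basis. coeff (monom (x \<bullet> c) (basis_index c)) (basis_index b))
          = (\<Sum>c\<in>Basis. if c = b then x \<bullet> b else 0)"
    using b by (intro sum.cong) (auto simp: basis_index_eq_iff)
  then show ?thesis
    using b basis_index_less[OF b] by (simp add: monic_poly_def coeff_sum)
qed

lemma coeff_monic_poly_ge:
  "DIM('a) \<le> i \<Longrightarrow> coeff (monic_poly x) i = (if i = DIM('a) then 1 else 0)" for x :: "'a::euclidean_space"
proof -
  assume i: "DIM('a) \<le> i"
  have "(\<Sum>c\<in>Basis. coeff (monom (x \<bullet> c) (basis_index c)) i) = 0"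
    using basis_index_less i by (intro sum.neutral) fastforce
  then show ?thesis by (auto simp: monic_poly_def coeff_sum)
qed

lemma degree_monic_poly: "degree (monic_poly x) = DIM('a)" for x :: "'a::euclidean_space"
  by (intro antisym degree_le le_degree) (auto simp: coeff_monic_poly_ge)

lemma monic_poly_coeff_vector:
  assumes "degree p \<le> DIM('a)" "coeff p DIM('a) = 1"
  shows "monic_poly (coeff_vector p :: 'a::euclidean_space) = p"
proof (rule poly_eqI)
  fix i
  show "coeff (monic_poly (coeff_vector p :: 'a)) i = coeff p i"
  proof (cases "i < DIM('a)")
    case True
    then obtain b :: 'a where "b \<in> Basis" "i = basis_index b"
      using bij_basis_index[where 'a='a] by (auto simp: bij_betw_def image_iff set_eq_iff)
    then show ?thesis by (simp add: coeff_monic_poly_index coeff_vector_inner)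
  next
    case False
    then show ?thesis using assms by (auto simp: coeff_monic_poly_ge coeff_eq_0)
  qed
qed

lemma coeff_vector_monic_poly: "coeff_vector (monic_poly x) = x"
  by (rule euclidean_eqI) (simp add: coeff_vector_inner coeff_monic_poly_index)

lemma poly_monic_poly:
  "poly (monic_poly x) t = t ^ DIM('a) + x \<bullet> (\<Sum>b\<in>Basis. t ^ basis_index b *\<^sub>R b)" for x :: "'a::euclidean_space"
  by (simp add: monic_poly_def poly_sum poly_monom inner_sum_right mult.commute)

section \<open>The hyperplanes of polynomials with a given root\<close>

definition root_hyperplane :: "real \<Rightarrow> 'a::euclidean_space set" where
  "root_hyperplane t = {x. poly (monic_poly x) t = 0}"

lemma hyperplane_root_hyperplane: "hyperplane (root_hyperplane t :: 'a::euclidean_space set)"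
proof -
  let ?a = "\<Sum>b\<in>Basis. t ^ basis_index b *\<^sub>R b :: 'a"
  have "0 \<in> {..<DIM('a)}" by simp
  then obtain b :: 'a where b: "b \<in> Basis" "basis_index b = 0"
    using bij_basis_index[where 'a='a] unfolding bij_betw_def by (metis imageE)
  have "?a \<bullet> b = 1" using b by (simp add: inner_sum_left_Basis)
  then have "?a \<noteq> 0" by auto
  moreover have "root_hyperplane t = {x. ?a \<bullet> x = - (t ^ DIM('a))}"
    by (auto simp: root_hyperplane_def poly_monic_poly inner_commute)
  ultimately show ?thesis unfolding hyperplane_def by blast
qed

definition root_poly :: "real set \<Rightarrow> real poly" where
  "root_poly V = (\<Prod>v\<in>V. [:- v, 1:])"

lemma poly_root_poly: "finite V \<Longrightarrow> poly (root_poly V) t = 0 \<longleftrightarrow> t \<in> V"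
  by (auto simp: root_poly_def poly_prod)

lemma degree_root_poly: "degree (root_poly V) = card V"
  unfolding root_poly_def by (subst degree_prod_eq_sum_degree) auto

lemma coeff_root_poly_card: "coeff (root_poly V) (card V) = 1"
  using lead_coeff_prod[of "\<lambda>v. [:- v, 1:]" V] degree_root_poly[of V]
  by (simp add: root_poly_def)

text \<open>The polynomial \<open>(T - s)\<^sup>d\<close> lies on the hyperplane of \<open>s\<close> and on no other one.\<close>

lemma inj_root_hyperplane: "inj (root_hyperplane :: real \<Rightarrow> 'a::euclidean_space set)"
proof (rule injI)
  fix s t assume eq: "root_hyperplane s = (root_hyperplane t :: 'a set)"
  let ?p = "[:- s, 1:] ^ DIM('a)"
  have "coeff ?p DIM('a) = 1" "degree ?p \<le> DIM('a)"
    using lead_coeff_power[of "[:- s, 1:]" "DIM('a)"] degree_power_eq[of "[:- s, 1:]" "DIM('a)"] by simp_all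
  then have p: "monic_poly (coeff_vector ?p :: 'a) = ?p" by (rule monic_poly_coeff_vector[rotated])
  have "(coeff_vector ?p :: 'a) \<in> root_hyperplane s"
    by (simp add: root_hyperplane_def p)
  then have "poly ?p t = 0" unfolding eq by (simp add: root_hyperplane_def p)
  then show "s = t" by simp
qed

lemma card_root_hyperplane_image:
  "card (root_hyperplane ` V :: 'a::euclidean_space set set) = card V"
  by (rule card_image[OF inj_on_subset[OF inj_root_hyperplane subset_UNIV]])

lemma root_hyperplanes_meet_once:
  assumes "card V = DIM('a)"
  shows "\<exists>!x :: 'a::euclidean_space. x \<in> \<Inter>(root_hyperplane ` V)"
proof (rule ex1I)
  have V: "finite V" using assms card_ge_0_finite[of V] by simp
  have *: "monic_poly (coeff_vector (root_poly V) :: 'a) = root_poly V"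
    using assms degree_root_poly[of V] coeff_root_poly_card[of V] by (intro monic_poly_coeff_vector) auto
  then show "(coeff_vector (root_poly V) :: 'a) \<in> \<Inter>(root_hyperplane ` V)"
    using V by (auto simp: root_hyperplane_def poly_root_poly)
  fix x :: 'a assume x: "x \<in> \<Inter>(root_hyperplane ` V)"
  have "monic_poly x = root_poly V"
    using x V assms degree_root_poly[of V] coeff_root_poly_card[of V]
    by (intro poly_eqI_degree_lead_coeff[of _ "DIM('a)" _ V])
       (auto simp: degree_monic_poly coeff_monic_poly_ge root_hyperplane_def poly_root_poly)
  then show "x = coeff_vector (root_poly V)" by (metis coeff_vector_monic_poly)
qed

lemma root_hyperplanes_no_common_point:
  assumes "card V = DIM('a) + 1"
  shows "\<Inter>(root_hyperplane ` V) = ({} :: 'a::euclidean_space set)"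
proof (rule ccontr)
  assume "\<Inter>(root_hyperplane ` V) \<noteq> ({} :: 'a set)"
  then obtain x :: 'a where x: "\<And>v. v \<in> V \<Longrightarrow> poly (monic_poly x) v = 0"
    by (auto simp: root_hyperplane_def)
  have "monic_poly x = 0"
    using x assms by (intro poly_eqI_degree[of V]) (auto simp: degree_monic_poly)
  then show False using degree_monic_poly[of x] by simp
qed

lemma general_position_root_hyperplanes:
  assumes "finite V" "DIM('a) + 1 \<le> card V"
  shows "general_position (root_hyperplane ` V :: 'a::euclidean_space set set)"
proof -
  have sub: "\<exists>W. \<T> = root_hyperplane ` W \<and> card W = card \<T>"
    if "\<T> \<subseteq> root_hyperplane ` V" for \<T> :: "'a set set"
    using that card_root_hyperplane_image by (metis subset_image_iff)
  show ?thesis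
    unfolding general_position_def
  proof (intro conjI ballI allI impI)
    fix \<T> :: "'a set set" assume "\<T> \<subseteq> root_hyperplane ` V" "card \<T> = DIM('a)"
    then show "\<exists>!x. x \<in> \<Inter>\<T>" using sub root_hyperplanes_meet_once by metis
  next
    fix \<T> :: "'a set set" assume "\<T> \<subseteq> root_hyperplane ` V" "card \<T> = DIM('a) + 1"
    then show "\<Inter>\<T> = {}" using sub root_hyperplanes_no_common_point by metis
  qed (use assms hyperplane_root_hyperplane in \<open>auto simp: card_root_hyperplane_image\<close>)
qed

text \<open>The coefficient of \<open>\<Prod>v\<in>U - {u}. (T - v)\<close> when the polynomial of \<open>x\<close> is interpolated on the
nodes \<open>U\<close>. For \<open>card U = d + 1\<close> these nodal polynomials are monic of degree \<open>d\<close>, and they are the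
vertices of the simplex.\<close>

definition lagrange_coord :: "real set \<Rightarrow> real \<Rightarrow> 'a::euclidean_space \<Rightarrow> real" where
  "lagrange_coord U u x = poly (monic_poly x) u / poly (root_poly (U - {u})) u"

lemma continuous_on_lagrange_coord:
  "continuous_on UNIV (lagrange_coord U u :: 'a::euclidean_space \<Rightarrow> real)"
  unfolding lagrange_coord_def [abs_def] poly_monic_poly divide_inverse by (intro continuous_intros)

lemma lagrange_coord_eq_0_iff:
  "finite U \<Longrightarrow> lagrange_coord U u x = 0 \<longleftrightarrow> x \<in> root_hyperplane u"
  by (simp add: lagrange_coord_def root_hyperplane_def poly_root_poly)

text \<open>Comparing leading coefficients in the interpolation formula shows that the Lagrange coordinates sum
to 1, so they are barycentric coordinates and \<open>unique_bounded_cell\<close> applies.\<close>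

lemma induced_simplex_root_hyperplanes:
  assumes card: "card U = DIM('a) + 1"
  shows "induced_simplex (root_hyperplane ` U :: 'a::euclidean_space set set)
           = closure {x. \<forall>u\<in>U. lagrange_coord U u x > 0}"
proof -
  have U: "finite U" "U \<noteq> {}" using card card_ge_0_finite[of U] by auto
  define P :: "real \<Rightarrow> 'a" where "P u = coeff_vector (root_poly (U - {u}))" for u
  have deg: "degree (root_poly (U - {u})) = DIM('a)" "coeff (root_poly (U - {u})) DIM('a) = 1"
    if "u \<in> U" for u
    using that U card degree_root_poly[of "U - {u}"] coeff_root_poly_card[of "U - {u}"] by auto
  (* At a node u all nodal polynomials except the one of u vanish. *)
  have val: "(\<Sum>v\<in>U. c v * poly (root_poly (U - {v})) u) = c u * poly (root_poly (U - {u})) u"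
    if "u \<in> U" for c u
  proof -
    have "(\<Sum>v\<in>U - {u}. c v * poly (root_poly (U - {v})) u) = 0"
      using that U by (intro sum.neutral) (auto simp: poly_root_poly)
    then show ?thesis using that U by (simp add: sum.remove[of U u])
  qed
  have interp: "monic_poly x = (\<Sum>u\<in>U. smult (lagrange_coord U u x) (root_poly (U - {u})))"
    for x :: 'a
  proof (rule poly_eqI_degree[of U])
    fix u assume "u \<in> U"
    then show "poly (monic_poly x) u = poly (\<Sum>u\<in>U. smult (lagrange_coord U u x) (root_poly (U - {u}))) u"
      using U val[of u "\<lambda>u. lagrange_coord U u x"]
      by (simp add: poly_sum lagrange_coord_def poly_root_poly)
  next
    have "degree (\<Sum>u\<in>U. smult (lagrange_coord U u x) (root_poly (U - {u}))) \<le> DIM('a)"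
      using deg U by (intro degree_sum_le) (auto intro: order_trans[OF degree_smult_le])
    then show "degree (\<Sum>u\<in>U. smult (lagrange_coord U u x) (root_poly (U - {u}))) < card U"
      using card by simp
  qed (simp add: degree_monic_poly card)
  have "(THE c. c \<in> components {x. \<forall>u\<in>U. lagrange_coord U u x \<noteq> 0} \<and> bounded c)
          = {x :: 'a. \<forall>u\<in>U. lagrange_coord U u x > 0}"
  proof (rule unique_bounded_cell[OF U, where P = P])
    fix x :: 'a
    have "coeff (monic_poly x) DIM('a) = (\<Sum>u\<in>U. lagrange_coord U u x)"
      by (subst interp) (simp add: coeff_sum deg)
    then show "(\<Sum>u\<in>U. lagrange_coord U u x) = 1" by (simp add: coeff_monic_poly_ge)
    have "x = coeff_vector (monic_poly x)" by (simp add: coeff_vector_monic_poly)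
    also have "\<dots> = (\<Sum>u\<in>U. lagrange_coord U u x *\<^sub>R P u)"
      by (subst interp) (simp add: coeff_vector_sum coeff_vector_smult P_def)
    finally show "(\<Sum>u\<in>U. lagrange_coord U u x *\<^sub>R P u) = x" by simp
  next
    fix y :: "real \<Rightarrow> real" and u assume y: "sum y U = 1" and u: "u \<in> U"
    let ?q = "\<Sum>v\<in>U. smult (y v) (root_poly (U - {v}))"
    have "(\<Sum>v\<in>U. y v *\<^sub>R P v) = coeff_vector ?q"
      by (simp add: coeff_vector_sum coeff_vector_smult P_def)
    moreover have "monic_poly (coeff_vector ?q :: 'a) = ?q"
    proof (rule monic_poly_coeff_vector)
      show "degree ?q \<le> DIM('a)"
        using deg U by (intro degree_sum_le) (auto intro: order_trans[OF degree_smult_le])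
      show "coeff ?q DIM('a) = 1" using y by (simp add: coeff_sum deg)
    qed
    ultimately show "lagrange_coord U u (\<Sum>v\<in>U. y v *\<^sub>R P v) = y u"
      using u U val[of u y] by (simp add: lagrange_coord_def poly_sum poly_root_poly)
  qed (rule continuous_on_lagrange_coord)
  moreover have "- \<Union>(root_hyperplane ` U) = {x :: 'a. \<forall>u\<in>U. lagrange_coord U u x \<noteq> 0}"
    using U by (auto simp: lagrange_coord_eq_0_iff)
  ultimately show ?thesis by (simp add: induced_simplex_def cells_def)
qed

section \<open>Shifting all roots preserves volumes\<close>

definition shift_roots :: "real \<Rightarrow> 'a::euclidean_space \<Rightarrow> 'a" where
  "shift_roots s x = coeff_vector (pcompose (monic_poly x) [:- s, 1:])"

lemma monic_poly_shift_roots: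
  "monic_poly (shift_roots s x) = pcompose (monic_poly x) [:- s, 1:]" for x :: "'a::euclidean_space"
  unfolding shift_roots_def
proof (rule monic_poly_coeff_vector)
  show "degree (pcompose (monic_poly x) [:- s, 1:]) \<le> DIM('a)"
    by (simp add: degree_pcompose degree_monic_poly)
  show "coeff (pcompose (monic_poly x) [:- s, 1:]) DIM('a) = 1"
    using lead_coeff_comp[of "[:- s, 1:]" "monic_poly x"]
    by (simp add: degree_pcompose degree_monic_poly coeff_monic_poly_ge)
qed

lemma shift_roots_inverse: "shift_roots (- s) (shift_roots s x) = x"
  by (subst shift_roots_def)
     (simp add: monic_poly_shift_roots coeff_vector_monic_poly pcompose_pCons flip: pcompose_assoc)

lemma shift_roots_add_scaleR:
  assumes c: "c \<in> Basis"
  shows "shift_roots s (x + y *\<^sub>R c)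
           = shift_roots s x + y *\<^sub>R coeff_vector (pcompose (monom 1 (basis_index c)) [:- s, 1:])"
proof -
  have "(\<Sum>b\<in>Basis. monom (y * (c \<bullet> b)) (basis_index b)) = monom y (basis_index c)"
    using c by (subst sum.remove[of _ c]) (auto simp: inner_Basis intro!: sum.neutral split: if_splits)
  then have "monic_poly (x + y *\<^sub>R c) = monic_poly x + smult y (monom 1 (basis_index c))"
    by (simp add: monic_poly_def inner_add_left sum.distrib smult_monom flip: add_monom)
  then show ?thesis
    by (simp add: shift_roots_def pcompose_add pcompose_smult coeff_vector_add coeff_vector_smult)
qed

lemma continuous_on_shift_roots: "continuous_on S (shift_roots s :: 'a::euclidean_space \<Rightarrow> 'a)"
proof -
  have "shift_roots s = (\<lambda>x :: 'a. coeff_vector (pcompose (monom 1 DIM('a)) [:- s, 1:])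
      + (\<Sum>b\<in>Basis. (x \<bullet> b) *\<^sub>R coeff_vector (pcompose (monom 1 (basis_index b)) [:- s, 1:])))"
  proof
    fix x :: 'a
    have "monic_poly x = monom 1 DIM('a) + (\<Sum>b\<in>Basis. smult (x \<bullet> b) (monom 1 (basis_index b)))"
      by (simp add: monic_poly_def smult_monom)
    then show "shift_roots s x = coeff_vector (pcompose (monom 1 DIM('a)) [:- s, 1:])
      + (\<Sum>b\<in>Basis. (x \<bullet> b) *\<^sub>R coeff_vector (pcompose (monom 1 (basis_index b)) [:- s, 1:]))"
      by (simp add: shift_roots_def pcompose_add pcompose_sum pcompose_smult
            coeff_vector_add coeff_vector_sum coeff_vector_smult)
  qed
  then show ?thesis by (auto intro!: continuous_intros)
qed

text \<open>The polynomial \<open>(T - s)\<^sup>k\<close> has leading term \<open>T\<^sup>k\<close>. So a change of the coefficient of \<open>T\<^sup>k\<close> passes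
unaltered to the same coefficient of the shifted polynomial, affects the lower ones, and leaves the
higher ones alone.\<close>

lemma lborel_distr_shift_roots:
  "distr lborel borel (shift_roots s) = (lborel :: 'a::euclidean_space measure)"
proof (rule lborel_distr_unitriangular[where r = basis_index])
  show "inj_on basis_index (Basis :: 'a set)"
    using bij_basis_index bij_betw_def by blast
  show "shift_roots s \<in> borel_measurable (borel :: 'a measure)"
    by (rule borel_measurable_continuous_onI[OF continuous_on_shift_roots])
  fix b c x :: 'a and y
  assume b: "b \<in> Basis" and c: "c \<in> Basis" and le: "basis_index c \<le> basis_index b"
  let ?q = "pcompose (monom 1 (basis_index c)) [:- s, 1:]"
  have deg: "degree ?q = basis_index c"
    by (simp add: degree_pcompose degree_monom_eq)
  have "coeff ?q (basis_index b) = c \<bullet> b"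
  proof (cases "b = c")
    case True
    then show ?thesis
      using lead_coeff_comp[of "[:- s, 1:]" "monom 1 (basis_index c)"] deg c
      by (simp add: degree_monom_eq)
  next
    case False
    then have "basis_index c < basis_index b"
      using le b c basis_index_eq_iff[of b c] by simp
    then show ?thesis using False b c deg by (simp add: coeff_eq_0 inner_Basis)
  qed
  then show "(shift_roots s (x + y *\<^sub>R c) - (x + y *\<^sub>R c)) \<bullet> b = (shift_roots s x - x) \<bullet> b"
    using b c by (simp add: shift_roots_add_scaleR coeff_vector_inner inner_simps)
qed

lemma lagrange_coord_shift_roots:
  "lagrange_coord ((\<lambda>u. u + s) ` U) (u + s) (shift_roots s x) = lagrange_coord U u x"
proof -
  have eq: "(\<lambda>u. u + s) ` U - {u + s} = (\<lambda>u. u + s) ` (U - {u})" by auto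
  show ?thesis
    unfolding lagrange_coord_def eq root_poly_def
    by (simp add: monic_poly_shift_roots poly_pcompose poly_prod prod.reindex)
qed

text \<open>The shift is a homeomorphism that turns Lagrange coordinates for \<open>U\<close> into those for the translate
of \<open>U\<close>, so it maps one simplex onto the other.\<close>

lemma measure_simplex_shift_roots:
  fixes U :: "real set"
  assumes card: "card U = DIM('a) + 1"
  shows "measure lborel (induced_simplex (root_hyperplane ` (\<lambda>u. u + s) ` U :: 'a::euclidean_space set set))
           = measure lborel (induced_simplex (root_hyperplane ` U :: 'a set set))"
proof -
  let ?C = "\<lambda>U. {x :: 'a. \<forall>u\<in>U. lagrange_coord U u x > 0}"
  have card': "card ((\<lambda>u. u + s) ` U) = DIM('a) + 1"
    using card by (simp add: card_image)
  have inv: "shift_roots (- s) (shift_roots s x) = x" "shift_roots s (shift_roots (- s) x) = x" for x :: 'a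
    using shift_roots_inverse[of s x] shift_roots_inverse[of "- s" x] by simp_all
  have vimage: "shift_roots s -` closure (?C ((\<lambda>u. u + s) ` U)) = closure (?C U)"
  proof
    let ?D = "?C ((\<lambda>u. u + s) ` U)"
    have CD: "x \<in> ?C U \<longleftrightarrow> shift_roots s x \<in> ?D" for x
      by (simp add: lagrange_coord_shift_roots)
    have "shift_roots s ` ?C U \<subseteq> closure ?D"
    proof (rule image_subsetI)
      fix x assume "x \<in> ?C U"
      then have "shift_roots s x \<in> ?D" using CD by simp
      then show "shift_roots s x \<in> closure ?D" using closure_subset by (rule rev_subsetD)
    qed
    then have "shift_roots s ` closure (?C U) \<subseteq> closure ?D"
      by (intro image_closure_subset continuous_on_shift_roots closed_closure)
    then show "closure (?C U) \<subseteq> shift_roots s -` closure ?D"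
      by (simp only: image_subset_iff_subset_vimage)
    have "shift_roots (- s) ` ?D \<subseteq> closure (?C U)"
    proof (rule image_subsetI)
      fix y assume "y \<in> ?D"
      then have "shift_roots (- s) y \<in> ?C U" by (subst CD) (simp only: inv)
      then show "shift_roots (- s) y \<in> closure (?C U)" using closure_subset by (rule rev_subsetD)
    qed
    then have bwd: "shift_roots (- s) ` closure ?D \<subseteq> closure (?C U)"
      by (intro image_closure_subset continuous_on_shift_roots closed_closure)
    show "shift_roots s -` closure ?D \<subseteq> closure (?C U)"
    proof
      fix x assume "x \<in> shift_roots s -` closure ?D"
      then have "shift_roots (- s) (shift_roots s x) \<in> closure (?C U)"
        using bwd by blast
      then show "x \<in> closure (?C U)" by (simp only: inv)
    qed
  qed
  have meas: "shift_roots s \<in> borel_measurable (borel :: 'a measure)"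
    by (rule borel_measurable_continuous_onI[OF continuous_on_shift_roots])
  have preserve: "measure lborel E = measure lborel (shift_roots s -` E)" if "closed E" for E :: "'a set"
  proof -
    have "measure lborel E = measure (distr lborel borel (shift_roots s)) E"
      by (simp add: lborel_distr_shift_roots)
    also have "\<dots> = measure lborel (shift_roots s -` E)"
      using that meas by (subst measure_distr) simp_all
    finally show ?thesis .
  qed
  show ?thesis
    unfolding induced_simplex_root_hyperplanes[OF card] induced_simplex_root_hyperplanes[OF card']
    by (subst preserve) (simp, simp only: vimage)
qed

section \<open>Counting simplices up to translation\<close>

text \<open>A set of \<open>d + 1\<close> parameters is, up to translation, the set of the \<open>d\<close> positive distances of its
elements from the smallest one. Two different sets with the same distances would give simplices of
equal volume.\<close>

lemma binomial_le_of_distinct_volumes: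
  fixes B :: "nat set"
  assumes B: "B \<subseteq> {..<n}"
    and dist: "distinct_volumes (root_hyperplane ` real ` B :: 'a::euclidean_space set set)"
  shows "card B choose (DIM('a) + 1) \<le> n choose DIM('a)"
proof -
  have finB: "finite B" using B finite_subset by blast
  define X where "X = {U. U \<subseteq> B \<and> card U = DIM('a) + 1}"
  define diffs :: "nat set \<Rightarrow> nat set" where "diffs U = (\<lambda>k. k - Min U) ` (U - {Min U})" for U
  have X: "finite U" "Min U \<in> U" "\<And>k. k \<in> U \<Longrightarrow> Min U \<le> k" if "U \<in> X" for U
  proof -
    show fin: "finite U" using that finB finite_subset by (auto simp: X_def)
    have "U \<noteq> {}" using that by (auto simp: X_def)
    with fin show "Min U \<in> U" "\<And>k. k \<in> U \<Longrightarrow> Min U \<le> k" by auto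
  qed
  have recover: "U = (\<lambda>d. Min U + d) ` insert 0 (diffs U)" if "U \<in> X" for U
    using X[OF that] by (force simp: diffs_def image_image)
  have "diffs ` X \<subseteq> {W. W \<subseteq> {..<n} \<and> card W = DIM('a)}"
  proof clarify
    fix U assume U: "U \<in> X"
    have "card (diffs U) = card (U - {Min U})"
      unfolding diffs_def using X(3)[OF U] by (intro card_image) (auto simp: inj_on_def eq_diff_iff)
    then have "card (diffs U) = DIM('a)"
      using X[OF U] U by (simp add: X_def)
    moreover have "diffs U \<subseteq> {..<n}"
      using U B by (force simp: diffs_def X_def)
    ultimately show "diffs U \<subseteq> {..<n} \<and> card (diffs U) = DIM('a)" by blast
  qed
  moreover have "inj_on diffs X"
  proof (rule inj_onI)
    fix U U' assume U: "U \<in> X" and U': "U' \<in> X" and eq: "diffs U = diffs U'"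
    have real_image: "real ` V = (\<lambda>d. real (Min V) + real d) ` insert 0 (diffs V)" if "V \<in> X" for V
      by (subst recover[OF that]) (simp add: image_image)
    let ?s = "real (Min U') - real (Min U)"
    have shift: "real ` U' = (\<lambda>u. u + ?s) ` real ` U"
      unfolding real_image[OF U'] real_image[OF U] eq image_image by (simp add: add.commute)
    have cards: "card (real ` V) = DIM('a) + 1" if "V \<in> X" for V
      using that by (simp add: X_def card_image)
    have same: "measure lborel (induced_simplex (root_hyperplane ` real ` U' :: 'a set set))
            = measure lborel (induced_simplex (root_hyperplane ` real ` U :: 'a set set))"
      unfolding shift by (rule measure_simplex_shift_roots[OF cards[OF U]])
    have mem: "root_hyperplane ` real ` V
        \<in> {\<T> :: 'a set set. \<T> \<subseteq> root_hyperplane ` real ` B \<and> card \<T> = DIM('a) + 1}"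
      if "V \<in> X" for V
      using that cards[OF that] by (simp add: X_def card_root_hyperplane_image image_mono)
    have "root_hyperplane ` real ` U' = (root_hyperplane ` real ` U :: 'a set set)"
      by (rule inj_onD[OF dist[unfolded distinct_volumes_def] same mem[OF U'] mem[OF U]])
    then have "real ` U' = real ` U"
      by (simp add: inj_image_eq_iff[OF inj_root_hyperplane])
    then show "U = U'" by (simp add: inj_image_eq_iff)
  qed
  ultimately have "card X \<le> card {W. W \<subseteq> {..<n} \<and> card W = DIM('a)}"
    by (intro card_inj_on_le) (auto intro: finite_subset[of _ "Pow {..<n}"])
  then show ?thesis by (simp add: X_def n_subsets[OF finB] n_subsets)
qed

text \<open>The existence of an arrangement in general position bounds the numbers over which the greatest one
is taken, so that the greatest one has the property in question. That property is then applied to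
the hyperplanes with parameters \<open>0, ..., n - 1\<close>.\<close>

lemma distinct_volume_number_le_powr:
  assumes n: "DIM('a) + 1 \<le> n"
  shows "real (distinct_volume_number TYPE('a::euclidean_space) n)
           \<le> (DIM('a) + 1) * real n powr (real DIM('a) / (DIM('a) + 1))"
proof -
  let ?d = "DIM('a)"
  let ?A = "root_hyperplane ` real ` {..<n} :: 'a set set"
  let ?P = "\<lambda>m. \<forall>\<A> :: 'a set set. general_position \<A> \<and> card \<A> = n \<longrightarrow>
        (\<exists>\<S>\<subseteq>\<A>. card \<S> = m \<and> distinct_volumes \<S>)"
  have gp: "general_position ?A"
    using n by (intro general_position_root_hyperplanes) (auto simp: card_image)
  have card_A: "card ?A = n"
    by (simp add: card_root_hyperplane_image card_image)
  define m where "m = distinct_volume_number TYPE('a) n"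
  have "?P m"
    unfolding m_def distinct_volume_number_def
  proof (rule GreatestI_nat)
    show "?P 0"
    proof (intro allI impI exI conjI)
      show "distinct_volumes ({} :: 'a set set)" by (auto simp: distinct_volumes_def inj_on_def)
    qed auto
    fix k assume "?P k"
    then obtain \<S> where "\<S> \<subseteq> ?A" "card \<S> = k" using gp card_A by blast
    then show "k \<le> n" using card_mono[of ?A \<S>] card_A by simp
  qed
  then obtain \<S> where \<S>: "\<S> \<subseteq> ?A" "card \<S> = m" "distinct_volumes \<S>" using gp card_A by blast
  then obtain B where B: "B \<subseteq> {..<n}" "\<S> = root_hyperplane ` real ` B"
    by (auto simp: subset_image_iff)
  have "card B = m"
    using \<S>(2) B(2) by (simp add: card_root_hyperplane_image card_image)
  then have "m choose (?d + 1) \<le> n choose ?d"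
    using binomial_le_of_distinct_volumes[OF B(1)] \<S>(3) B(2) by simp
  also have "\<dots> \<le> n ^ ?d" using n by (intro binomial_le_pow) simp
  finally have choose: "m choose (?d + 1) \<le> n ^ ?d" .
  have "real m \<le> (?d + 1) * real n powr (real ?d / (?d + 1))"
  proof (cases "?d + 1 \<le> m")
    case True
    have "(real m / (?d + 1)) ^ (?d + 1) \<le> real (m choose (?d + 1))"
      using binomial_ge_n_over_k_pow_k[OF True, where 'a = real] by (simp add: add_ac)
    also have "\<dots> \<le> real n ^ ?d" using choose by (metis of_nat_le_iff of_nat_power)
    also have "\<dots> = real n powr (real ?d / (?d + 1) * real (?d + 1))"
      using n by (simp add: powr_realpow)
    also have "\<dots> = (real n powr (real ?d / (?d + 1))) ^ (?d + 1)"
      using n by (subst powr_realpow[symmetric]) (simp_all only: powr_powr powr_gt_zero)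
    finally have "real m / (?d + 1) \<le> real n powr (real ?d / (?d + 1))"
      unfolding Suc_eq_plus1[symmetric] by (rule power_le_imp_le_base) simp
    then show ?thesis by (simp add: field_simps)
  next
    (* At most d of the hyperplanes form no simplex at all, and the bound is trivial. *)
    case False
    have "real m \<le> real (?d + 1) * 1" using False by simp
    also have "\<dots> \<le> (?d + 1) * real n powr (real ?d / (?d + 1))"
      using n by (intro mult_left_mono ge_one_powr_ge_zero) auto
    finally show ?thesis .
  qed
  then show ?thesis by (simp add: m_def)
qed

section \<open>Comparison with the logarithmic bounds\<close>

text \<open>A power saving beats a logarithm: \<open>ln n \<le> (d + 1) n\<^bsup>1/(d+1)\<^esup>\<close>, by \<open>ln y \<le> y\<close> for
\<open>y = n\<^bsup>1/(d+1)\<^esup>\<close>. So the estimate above saves at least a factor of order \<open>ln n\<close>.\<close>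

lemma powr_mult_ln_le:
  assumes n: "n \<ge> 1"
  shows "n powr (real d / (d + 1)) * ln n \<le> (d + 1) * (n::real)"
proof -
  have "ln n / (d + 1) = ln (n powr (1 / (d + 1)))" by simp
  also have "\<dots> \<le> n powr (1 / (d + 1))"
    using n by (intro order_trans[OF ln_le_minus_one]) auto
  finally have "ln n \<le> (d + 1) * n powr (1 / (d + 1))" by (simp add: field_simps)
  then have "n powr (real d / (d + 1)) * ln n
      \<le> n powr (real d / (d + 1)) * ((d + 1) * n powr (1 / (d + 1)))"
    by (intro mult_left_mono) auto
  also have "\<dots> = (d + 1) * n powr (real d / (d + 1) + 1 / (d + 1))"
    by (simp add: powr_add)
  also have "real d / (d + 1) + 1 / (d + 1) = 1"
    by (simp add: field_simps)
  finally show ?thesis using n by (simp add: add.commute)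
qed

text \<open>Saving the factor \<open>ln n\<close> gives the first part with exponent 1. It also gives the second part with
exponent 1/2, since \<open>ln n = exp (ln (ln n))\<close> and \<open>\<surd>L \<le> 1 + L\<close> for \<open>L = ln (ln n) \<ge> 0\<close>.\<close>

theorem theorem1p5:
  shows "(\<exists>c>0. \<exists>C. \<forall>n\<ge>3.
            real (distinct_volume_number TYPE(real^2) n) \<le> C * (real n * ln (real n) powr (- c)))
       \<and> (CARD('d::finite) \<ge> 3 \<longrightarrow>
            (\<exists>c. 0 < c \<and> c < 1 \<and> (\<exists>C. \<forall>n\<ge>CARD('d) + 1.
               real (distinct_volume_number TYPE(real^'d) n)
                 \<le> C * (real n * exp (- (ln (ln (real n)) powr c))))))"
proof (intro conjI impI)
  have "real (distinct_volume_number TYPE(real^2) n) \<le> 9 * (real n * ln (real n) powr (- 1))"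
    if "n \<ge> 3" for n
  proof -
    have pos: "ln (real n) > 0" using that by simp
    have "real (distinct_volume_number TYPE(real^2) n) \<le> 3 * real n powr (2 / 3)"
      using distinct_volume_number_le_powr[where 'a = "real^2", of n] that by simp
    also have "\<dots> \<le> 3 * (3 * real n / ln (real n))"
      using powr_mult_ln_le[of "real n" 2] that pos by (simp add: field_simps)
    also have "\<dots> = 9 * (real n * ln (real n) powr (- 1))"
      using pos by (simp add: powr_minus_divide)
    finally show ?thesis .
  qed
  then show "\<exists>c>0. \<exists>C. \<forall>n\<ge>3.
      real (distinct_volume_number TYPE(real^2) n) \<le> C * (real n * ln (real n) powr (- c))"
    by (intro exI[of _ 1] conjI exI[of _ 9]) auto
next
  assume d: "CARD('d) \<ge> 3"
  let ?d = "CARD('d)"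
  have "real (distinct_volume_number TYPE(real^'d) n)
      \<le> (?d + 1)\<^sup>2 * exp 1 * (real n * exp (- (ln (ln (real n)) powr (1 / 2))))"
    if n: "n \<ge> ?d + 1" for n
  proof -
    (* Here n is at least 4, hence above e, and the iterated logarithm is nonnegative. *)
    have "exp 1 \<le> real n" using exp_le d n by linarith
    then have ln_ge: "ln (real n) \<ge> 1" using d n by (subst ln_ge_iff) auto
    then have ln_pos: "ln (real n) > 0" by linarith
    let ?L = "ln (ln (real n))"
    have L0: "?L \<ge> 0" using ln_ge by simp
    have sqrt_le: "sqrt ?L \<le> 1 + ?L"
      using L0 by (intro real_le_lsqrt) (auto simp: power2_eq_square algebra_simps)
    have "inverse (ln (real n)) = exp 1 * exp (- (1 + ?L))"
      using ln_pos by (simp add: exp_minus flip: exp_add)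
    also have "\<dots> \<le> exp 1 * exp (- (?L powr (1 / 2)))"
      using sqrt_le L0 by (simp add: powr_half_sqrt)
    finally have inv_ln: "inverse (ln (real n)) \<le> exp 1 * exp (- (?L powr (1 / 2)))" .
    have "real (distinct_volume_number TYPE(real^'d) n) \<le> (?d + 1) * real n powr (real ?d / (?d + 1))"
      using distinct_volume_number_le_powr[where 'a = "real^'d", of n] n by simp
    also have "\<dots> \<le> (?d + 1) * ((?d + 1) * real n * inverse (ln (real n)))"
      using powr_mult_ln_le[of "real n" ?d] n ln_pos by (intro mult_left_mono) (simp_all add: field_simps)
    also have "\<dots> = (?d + 1)\<^sup>2 * real n * inverse (ln (real n))"
      by (simp add: power2_eq_square algebra_simps)
    also have "\<dots> \<le> (?d + 1)\<^sup>2 * real n * (exp 1 * exp (- (?L powr (1 / 2))))"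
      using inv_ln by (intro mult_left_mono) auto
    finally show ?thesis by (simp add: mult_ac)
  qed
  then show "\<exists>c. 0 < c \<and> c < 1 \<and> (\<exists>C. \<forall>n\<ge>?d + 1.
      real (distinct_volume_number TYPE(real^'d) n) \<le> C * (real n * exp (- (ln (ln (real n)) powr c))))"
    by (intro exI[of _ "1 / 2"] conjI exI[of _ "(?d + 1)\<^sup>2 * exp 1"]) auto
qed

end
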